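(* Let $M$ be a finite set of nonzero integers and let $k$ be a positive integer with $|M|$ dividing $k$. Suppose that there is a direct KM-logarithm $f: M\to\mathbb{Z}_k$. Then there are infinitely many primes $p$ such that $M$ splits $\mathbb{Z}_p$.
   Context: $\mathbb{Z}_n$ denotes the integers modulo $n$. A subset $A$ of an abelian group $G$ is a direct factor of $G$ if there is $B\subseteq G$ with every element of $G$ uniquely of the form $a+b$, $a\in A$, $b\in B$. A direct logarithm is an injective function $f: M\to\mathbb{Z}_k$ with $f(xy)=f(x)+f(y)$ whenever $x,y,xy\in M$ and $f(M)$ a direct factor of $\mathbb{Z}_k$. A $k$-character on $\mathbb{Z}_p$ ($p$ prime) is a homomorphism $\chi:\mathbb{Z}_p^\ast\to\mathbb{Z}_k$. A direct KM-logarithm is a direct logarithm $f$ meeting the conditions of the Kummer–Mills theorem, i.e. such that there are infinitely many primes $p$ with $k$-characters $\chi$ on $\mathbb{Z}_p$ satisfying $\chi(m\bmod p)=f(m)$ for all $m\in M$. For a finite group $G$ (written additively) and a set $M$ of integers, $M$ splits $G$ if there is a subset $S\subseteq G$ such that every nonzero $g\in G$ has a unique representation $g=ms$ with $m\in M$, $s\in S$, while $0$ has no such representation (here $ms$ is the $m$-fold sum of $s$, with $ms=-((-m)s)$ for $m<0$). *)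

theory Defs
  imports "HOL-Number_Theory.Number_Theory" "HOL-Algebra.Elementary_Groups"
begin

text \<open>
  The additive group of integers modulo \<open>n\<close> is the library's \<^const>\<open>integer_mod_group\<close>, with carrier
  \<open>{0..<int n}\<close> for \<open>n > 0\<close>; the multiplicative group of nonzero residues modulo a prime \<open>p\<close> is the
  group of units of \<^const>\<open>residue_ring\<close>. Groups are in the multiplicative notation of
  HOL-Algebra, so a sum \<open>a + b\<close> reads \<open>a \<otimes> b\<close>, and the integer multiple \<open>m s\<close> reads \<open>s [^] m\<close>.
\<close>

definition direct_factor :: "('a, 'b) monoid_scheme \<Rightarrow> 'a set \<Rightarrow> bool" where
  "direct_factor G A \<longleftrightarrow> A \<subseteq> carrier G \<and>
     (\<exists>B \<subseteq> carrier G. \<forall>g \<in> carrier G.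
        \<exists>!ab. ab \<in> A \<times> B \<and> g = fst ab \<otimes>\<^bsub>G\<^esub> snd ab)"

definition direct_logarithm :: "nat \<Rightarrow> int set \<Rightarrow> (int \<Rightarrow> int) \<Rightarrow> bool" where
  "direct_logarithm k M f \<longleftrightarrow>
     f \<in> M \<rightarrow> carrier (integer_mod_group k) \<and>
     inj_on f M \<and>
     (\<forall>x \<in> M. \<forall>y \<in> M. x * y \<in> M \<longrightarrow> f (x * y) = f x \<otimes>\<^bsub>integer_mod_group k\<^esub> f y) \<and>
     direct_factor (integer_mod_group k) (f ` M)"

definition k_characters :: "nat \<Rightarrow> nat \<Rightarrow> (int \<Rightarrow> int) set" where
  "k_characters k p = hom (units_of (residue_ring (int p))) (integer_mod_group k)"

text \<open>
  A character is only meaningful on the carrier of its domain, so \<open>\<chi> (m mod p) = f m\<close> has to come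
  with the condition that \<open>m mod p\<close> is a unit modulo \<open>p\<close>.
\<close>

definition direct_KM_logarithm :: "nat \<Rightarrow> int set \<Rightarrow> (int \<Rightarrow> int) \<Rightarrow> bool" where
  "direct_KM_logarithm k M f \<longleftrightarrow>
     direct_logarithm k M f \<and>
     infinite {p :: nat. prime p \<and>
       (\<exists>\<chi> \<in> k_characters k p. \<forall>m \<in> M.
          m mod int p \<in> carrier (units_of (residue_ring (int p))) \<and> \<chi> (m mod int p) = f m)}"

definition splits :: "int set \<Rightarrow> ('a, 'b) monoid_scheme \<Rightarrow> bool" where
  "splits M G \<longleftrightarrow>
     (\<exists>S \<subseteq> carrier G.
        (\<forall>g \<in> carrier G - {\<one>\<^bsub>G\<^esub>}. \<exists>!ms. ms \<in> M \<times> S \<and> g = snd ms [^]\<^bsub>G\<^esub> fst ms) \<and>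
        (\<forall>m \<in> M. \<forall>s \<in> S. s [^]\<^bsub>G\<^esub> m \<noteq> \<one>\<^bsub>G\<^esub>))"

end

theory Submission
  imports Defs
begin

text \<open>
  A factorisation pulls back along a homomorphism: if \<open>\<chi>\<close> maps the residues of \<open>M\<close> bijectively onto
  a set with complement \<open>B\<close> in \<open>\<int>\<^sub>k\<close>, then the \<open>\<chi>\<close>-preimage of \<open>B\<close> is a complement of the residues of
  \<open>M\<close> in \<open>\<int>\<^sub>p\<^sup>*\<close>, because the factor from \<open>M\<close> is read off the image under \<open>\<chi>\<close> and the other factor
  is then the quotient.
\<close>

lemma direct_factor_pullback:
  assumes "group H" "group G" and \<chi>: "\<chi> \<in> hom H G"
    and h: "h \<in> M \<rightarrow> carrier H"
    and inj: "inj_on (\<lambda>m. \<chi> (h m)) M"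
    and factor: "direct_factor G ((\<lambda>m. \<chi> (h m)) ` M)"
  obtains S where "S \<subseteq> carrier H"
    and "\<And>g. g \<in> carrier H \<Longrightarrow> \<exists>!ms. ms \<in> M \<times> S \<and> g = h (fst ms) \<otimes>\<^bsub>H\<^esub> snd ms"
proof -
  interpret H: group H by fact
  interpret G: group G by fact
  interpret group_hom H G \<chi> by unfold_locales (rule \<chi>)
  obtain B where B: "B \<subseteq> carrier G"
    and unique: "\<forall>g \<in> carrier G.
      \<exists>!ab. ab \<in> ((\<lambda>m. \<chi> (h m)) ` M) \<times> B \<and> g = fst ab \<otimes>\<^bsub>G\<^esub> snd ab"
    using factor unfolding direct_factor_def by (elim conjE exE) (rule that)
  define S where "S = {s \<in> carrier H. \<chi> s \<in> B}"
  have "\<exists>!ms. ms \<in> M \<times> S \<and> g = h (fst ms) \<otimes>\<^bsub>H\<^esub> snd ms" if g: "g \<in> carrier H" for g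
  proof (rule ex_ex1I)
    \<comment> \<open>Existence: the complement \<open>B\<close> splits \<open>\<chi> g\<close> as
      \<chi> (h m) times some b in \<open>B\<close>. Dividing \<open>g\<close> by \<open>h m\<close>
      leaves an element that \<chi> sends to b, hence an element of \<open>S\<close>.\<close>
    obtain ab where "ab \<in> ((\<lambda>m. \<chi> (h m)) ` M) \<times> B" "\<chi> g = fst ab \<otimes>\<^bsub>G\<^esub> snd ab"
      using bspec[OF unique hom_closed[OF g]] by (elim ex1E conjE) (rule that)
    then obtain m b where m: "m \<in> M" and b: "b \<in> B" and eq: "\<chi> g = \<chi> (h m) \<otimes>\<^bsub>G\<^esub> b"
      by auto
    have hm: "h m \<in> carrier H" using h m by blast
    have "\<chi> (inv\<^bsub>H\<^esub> h m \<otimes>\<^bsub>H\<^esub> g) = b"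
      using eq hm g b B by (auto simp: G.inv_solve_left')
    then have "(m, inv\<^bsub>H\<^esub> h m \<otimes>\<^bsub>H\<^esub> g) \<in> M \<times> S"
      using m b hm g by (simp add: S_def)
    moreover have "g = h m \<otimes>\<^bsub>H\<^esub> (inv\<^bsub>H\<^esub> h m \<otimes>\<^bsub>H\<^esub> g)"
      using hm g by (simp flip: H.m_assoc)
    ultimately show "\<exists>ms. ms \<in> M \<times> S \<and> g = h (fst ms) \<otimes>\<^bsub>H\<^esub> snd ms"
      by force
  next
    fix u v
    assume u: "u \<in> M \<times> S \<and> g = h (fst u) \<otimes>\<^bsub>H\<^esub> snd u"
      and v: "v \<in> M \<times> S \<and> g = h (fst v) \<otimes>\<^bsub>H\<^esub> snd v"
    obtain m s where us: "u = (m, s)" by fastforce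
    obtain n t where vt: "v = (n, t)" by fastforce
    have mem: "m \<in> M" "n \<in> M" "s \<in> S" "t \<in> S" "h m \<in> carrier H" "h n \<in> carrier H"
        "s \<in> carrier H" "t \<in> carrier H"
      using u v h us vt by (auto simp: S_def)
    have g_eq: "g = h m \<otimes>\<^bsub>H\<^esub> s" "g = h n \<otimes>\<^bsub>H\<^esub> t"
      using u v us vt by simp_all
    have "\<chi> g = \<chi> (h m) \<otimes>\<^bsub>G\<^esub> \<chi> s"
      unfolding g_eq(1) using mem by simp
    moreover have "\<chi> g = \<chi> (h n) \<otimes>\<^bsub>G\<^esub> \<chi> t"
      unfolding g_eq(2) using mem by simp
    moreover have "\<chi> s \<in> B" "\<chi> t \<in> B"
      using mem by (simp_all add: S_def)
    \<comment> \<open>Uniqueness: both representations of \<open>g\<close> map to representations of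
      \<open>\<chi> g\<close> over the image of \<open>M\<close> and \<open>B\<close>, so these
      coincide.\<close>
    ultimately have "(\<chi> (h m), \<chi> s) = (\<chi> (h n), \<chi> t)"
      using mem by (intro Uniq_D[OF conjunct2[OF iffD1[OF ex1_iff_ex_Uniq bspec[OF unique hom_closed[OF g]]]]]) simp_all
    \<comment> \<open>The images agree only under \<chi>; injectivity recovers the element of
      \<open>M\<close> itself, and cancelling \<open>h m\<close> then identifies the
      cofactors.\<close>
    then have "m = n"
      using inj mem by (auto dest: inj_onD)
    moreover have "h m \<otimes>\<^bsub>H\<^esub> s = h n \<otimes>\<^bsub>H\<^esub> t"
      using g_eq by metis
    then have "s = t"
      using mem unfolding \<open>m = n\<close> by simp
    ultimately show "u = v"
      using us vt by simp
  qed
  then show thesis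
    using that[of S] by (auto simp: S_def)
qed

text \<open>The nonzero elements of the additive group modulo the prime \<open>p\<close> are exactly
  the units modulo \<open>p\<close>, and the multiple m s is the product of m mod p and s. So
  factoring the unit group by the residues of \<open>M\<close>, as pulling back along \<chi> allows,
  amounts to splitting the additive group.\<close>

lemma splits_if_character:
  assumes p: "prime p" and log: "direct_logarithm k M f"
    and \<chi>: "\<chi> \<in> k_characters k p"
    and M: "\<And>m. m \<in> M \<Longrightarrow> m mod int p \<in> carrier (units_of (residue_ring (int p)))"
    and \<chi>_eq: "\<And>m. m \<in> M \<Longrightarrow> \<chi> (m mod int p) = f m"
  shows "splits M (integer_mod_group p)"
proof -
  interpret R: residues_prime p "residue_ring (int p)"
    using p by unfold_locales
  have p_pos: "p > 0" using p by (rule prime_gt_0_nat)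
  have units: "carrier (units_of (residue_ring (int p))) = {1..int p - 1}"
    using R.res_prime_units_eq p_pos by (simp add: units_of_carrier)
  \<comment> \<open>On \<open>M\<close>, reduction modulo \<open>p\<close> followed by \<chi> is
    \<open>f\<close>, so injectivity and the direct factor carry over from \<open>f\<close>.\<close>
  have "inj_on (\<lambda>m. \<chi> (m mod int p)) M"
    using log \<chi>_eq by (simp add: direct_logarithm_def cong: inj_on_cong)
  moreover have "direct_factor (integer_mod_group k) ((\<lambda>m. \<chi> (m mod int p)) ` M)"
    using log \<chi>_eq by (simp add: direct_logarithm_def cong: image_cong)
  moreover have "\<chi> \<in> hom (units_of (residue_ring (int p))) (integer_mod_group k)"
    using \<chi> by (simp add: k_characters_def)
  moreover have "(\<lambda>m. m mod int p) \<in> M \<rightarrow> carrier (units_of (residue_ring (int p)))"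
    using M by blast
  ultimately obtain S where S: "S \<subseteq> {1..int p - 1}"
    and unique: "\<And>g. g \<in> {1..int p - 1} \<Longrightarrow>
      \<exists>!ms. ms \<in> M \<times> S \<and>
        g = (fst ms mod int p) \<otimes>\<^bsub>units_of (residue_ring (int p))\<^esub> snd ms"
    using direct_factor_pullback[OF R.units_group group_integer_mod_group]
    unfolding units by blast
  \<comment> \<open>The bridge between the two group structures: both sides are the integer product
    of \<open>m\<close> and \<open>s\<close> reduced modulo \<open>p\<close>.\<close>
  have mult: "(m mod int p) \<otimes>\<^bsub>units_of (residue_ring (int p))\<^esub> s = s [^]\<^bsub>integer_mod_group p\<^esub> m"
    for m s
    by (simp add: units_of_mult R.res_mult_eq int_pow_integer_mod_group mod_mult_left_eq)
  \<comment> \<open>Zero is not represented: \<open>p\<close> divides neither \<open>m\<close> nor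
    \<open>s\<close>, both being units modulo \<open>p\<close>, so by primality it does not divide
    their product.\<close>
  have "s [^]\<^bsub>integer_mod_group p\<^esub> m \<noteq> 0" if "m \<in> M" "s \<in> S" for m s
  proof -
    have "\<not> int p dvd m" "\<not> int p dvd s"
      using M[OF that(1)] that(2) S by (auto simp: units dvd_eq_mod_eq_0)
    then show ?thesis
      using p by (auto simp: int_pow_integer_mod_group prime_dvd_mult_iff
          simp flip: dvd_eq_mod_eq_0)
  qed
  moreover have "carrier (integer_mod_group p) - {0} = {1..int p - 1}"
    using p_pos by (auto simp: carrier_integer_mod_group)
  ultimately show ?thesis
    using S unique unfolding splits_def mult one_integer_mod_group
    by (intro exI[of _ S]) auto
qed

theorem theorem2p5:
  fixes M :: "int set" and k :: nat
  assumes "finite M" and "0 \<notin> M"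
    and "k > 0" and "card M dvd k"
    and "\<exists>f. direct_KM_logarithm k M f"
  shows "infinite {p :: nat. prime p \<and> splits M (integer_mod_group p)}"
proof -
  obtain f where log: "direct_logarithm k M f"
    and inf: "infinite {p :: nat. prime p \<and>
       (\<exists>\<chi> \<in> k_characters k p. \<forall>m \<in> M.
          m mod int p \<in> carrier (units_of (residue_ring (int p))) \<and> \<chi> (m mod int p) = f m)}"
    using assms(5) unfolding direct_KM_logarithm_def by blast
  show ?thesis
    \<comment> \<open>Each of the infinitely many primes with a character extending \<open>f\<close>
      is a prime for which \<open>M\<close> splits.\<close>
    by (rule infinite_super[OF _ inf]) (auto intro: splits_if_character[OF _ log])
qed

end
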